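(* Let $h$ be a positive even integer, and let $\mathcal{A}$ be a $B_h$-set with counting function $A(n)=|\mathcal{A}\cap[0,n)|$. Then $$\liminf_{n\to\infty} \frac{A(n)}{\sqrt[h]{n/\log n}} \le \left(\frac{\pi}{\log 2}\cdot\frac{\Gamma(1+\tfrac h2)^2}{\Gamma(1+\tfrac1h)^{h}}\right)^{1/h}.$$
   Context: A set $\mathcal{A}$ of nonnegative integers is a $B_h$-set if the sums $a_1+\cdots+a_h$ with $a_1\le\cdots\le a_h$ and all $a_i\in\mathcal{A}$ are distinct (i.e., distinct nondecreasing $h$-tuples of elements of $\mathcal{A}$ have distinct sums). $\log$ is the natural logarithm and $\Gamma$ is the Gamma function. *)

theory Defs
  imports "HOL-Analysis.Analysis"
begin

(* The nondecreasing h-tuples with entries in A are the sorted lists of length h over A. *)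
definition is_Bh_set :: "nat \<Rightarrow> nat set \<Rightarrow> bool" where
  "is_Bh_set h A \<longleftrightarrow> inj_on sum_list {xs. length xs = h \<and> sorted xs \<and> set xs \<subseteq> A}"

definition counting_fun :: "nat set \<Rightarrow> nat \<Rightarrow> nat" where
  "counting_fun A n = card (A \<inter> {0..<n})"

end

theory Submission
  imports Defs "HOL-Combinatorics.Multiset_Permutations" "HOL-Real_Asymp.Real_Asymp"
begin

text \<open>
  Write \<open>h = 2 * k\<close> and \<open>p = 1 / h\<close>, and suppose that \<open>A\<close> has at least
  \<open>c * (n / ln n) powr p\<close> elements below \<open>n\<close> for all large \<open>n\<close>. Let \<open>B\<close> be the set of elements of
  \<open>A\<close> up to \<open>\<tau> = N\<^sup>2 / ln N\<close>. The proof compares two estimates of the energy \<open>E\<^sub>m\<close>, the number of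
  solutions of \<open>a\<^sub>1 + \<dots> + a\<^sub>m + i = b\<^sub>1 + \<dots> + b\<^sub>m + j\<close> with \<open>a\<^sub>r\<close>, \<open>b\<^sub>r\<close> in \<open>B\<close> and
  \<open>i\<close>, \<open>j\<close> in \<open>{1..N}\<close>, for \<open>m = k\<close>.

  Upper bound (\<open>energy_upper_bound\<close>): for given \<open>i\<close>, \<open>j\<close> the \<open>B\<^sub>h\<close> property determines two disjoint
  tuples up to order, which gives at most \<open>(k!)\<^sup>2 * N\<^sup>2\<close> solutions. If the two tuples share an element, it
  can be cancelled, so there are at most \<open>k\<^sup>2 * card B * E\<^sub>k\<^sub>-\<^sub>1\<close> other solutions. The energies are
  log-convex in \<open>m\<close> and \<open>E\<^sub>0 = N\<close>, so this term is at most a small multiple of \<open>E\<^sub>k\<close> plus a constant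
  times \<open>(card B) ^ k * N\<close>; the latter is \<open>o(N\<^sup>2)\<close> because \<open>(card B) ^ h = O(\<tau>)\<close> and
  \<open>\<tau> = o(N\<^sup>2)\<close>.

  Lower bound (\<open>energy_lower_bound\<close>): by partial summation the sum \<open>f s\<close> of \<open>exp (- b * s)\<close> over
  \<open>b \<in> B\<close> is at least \<open>g * (s * ln (1 / s)) powr (- p)\<close> for \<open>L / \<tau> \<le> s\<close> and small \<open>s\<close>, for any
  \<open>g < c * Gamma (1 + p)\<close> (\<open>exp_sum_lower_bound\<close>). Put \<open>w s = (s * ln (1 / s)) powr (- 1 / 2)\<close>, so that
  \<open>f s ^ k \<ge> g ^ k * w s\<close>. Integrating \<open>w s * f s ^ k * (exp (- s) + \<dots> + exp (- N * s))\<close> over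
  \<open>s \<in> {L / \<tau>..1 / (N * ln N)}\<close> yields at least \<open>(1 - o(1)) * g ^ k * N * \<Lambda>\<close>, where
  \<open>\<Lambda>\<close> is the integral of \<open>w\<^sup>2\<close>, and \<open>\<Lambda>\<close> tends to \<open>ln 2\<close>. The same integral is a sum of values
  \<open>W t\<close> of the Laplace transform of \<open>w\<close> over all sums \<open>t = a\<^sub>1 + \<dots> + a\<^sub>k + i\<close>. By Cauchy-Schwarz its
  square is at most \<open>E\<^sub>k\<close> times the sum of \<open>(W t)\<^sup>2\<close>, and the latter sum is at most \<open>pi * \<Lambda>\<close>
  by a Hilbert-type inequality (\<open>sum_Laplace_square_le\<close>).

  Together, \<open>g ^ h * ln 2 \<le> pi * (k!)\<^sup>2\<close> in the limit (\<open>Bh_set_constant_bound\<close>), and letting \<open>g\<close> tend to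
  \<open>c * Gamma (1 + p)\<close> gives the stated bound for \<open>c\<close>.
\<close>

section \<open>Additive energy of tuples from a \<open>B\<^sub>h\<close> set\<close>

text \<open>The pairs of indices at which the families \<open>v\<close> on \<open>P\<close> and \<open>u\<close> on \<open>Q\<close> take equal values. For a
  single family, the number of these pairs is the sum of the squared multiplicities of its values.\<close>
definition matches :: "'a set \<Rightarrow> ('a \<Rightarrow> 'c) \<Rightarrow> 'b set \<Rightarrow> ('b \<Rightarrow> 'c) \<Rightarrow> ('a \<times> 'b) set" where
  "matches P v Q u = {(p, q). p \<in> P \<and> q \<in> Q \<and> v p = u q}"

lemma finite_matches: "finite P \<Longrightarrow> finite Q \<Longrightarrow> finite (matches P v Q u)"
  by (rule finite_subset[of _ "P \<times> Q"]) (auto simp: matches_def)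

lemma card_matches:
  assumes "finite P" "finite Q" "finite S" "v ` P \<subseteq> S"
  shows "card (matches P v Q u) = (\<Sum>t\<in>S. card {p\<in>P. v p = t} * card {q\<in>Q. u q = t})"
proof -
  have "matches P v Q u = (\<Union>t\<in>S. {p\<in>P. v p = t} \<times> {q\<in>Q. u q = t})"
    using assms(4) by (auto simp: matches_def)
  also have "card \<dots> = (\<Sum>t\<in>S. card ({p\<in>P. v p = t} \<times> {q\<in>Q. u q = t}))"
    using assms by (intro card_UN_disjoint) auto
  finally show ?thesis by (simp add: card_cartesian_product)
qed

text \<open>Cauchy-Schwarz for the multiplicities with which two families take their values.\<close>
lemma card_matches_square_le:
  assumes "finite P" "finite Q"
  shows "(card (matches P v Q u))\<^sup>2 \<le> card (matches P v P v) * card (matches Q u Q u)"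
proof -
  define S where "S = v ` P \<union> u ` Q"
  have S: "finite S" "v ` P \<subseteq> S" "u ` Q \<subseteq> S" using assms by (auto simp: S_def)
  have "real ((card (matches P v Q u))\<^sup>2)
      = (\<Sum>t\<in>S. real (card {p\<in>P. v p = t}) * real (card {q\<in>Q. u q = t}))\<^sup>2"
    using card_matches[OF assms S(1,2), of u] by simp
  also have "\<dots> \<le> (\<Sum>t\<in>S. (real (card {p\<in>P. v p = t}))\<^sup>2) * (\<Sum>t\<in>S. (real (card {q\<in>Q. u q = t}))\<^sup>2)"
    by (rule Cauchy_Schwarz_ineq_sum)
  also have "\<dots> = real (card (matches P v P v) * card (matches Q u Q u))"
    using card_matches[OF assms(1,1) S(1,2), of v] card_matches[OF assms(2,2) S(1,3), of u]
    by (simp add: power2_eq_square)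
  finally show ?thesis by (simp only: of_nat_le_iff)
qed

lemma sum_square_le_card_matches:
  fixes w :: "'b \<Rightarrow> real"
  assumes "finite P"
  shows "(\<Sum>p\<in>P. w (v p))\<^sup>2 \<le> card (matches P v P v) * (\<Sum>t\<in>v ` P. (w t)\<^sup>2)"
proof -
  have "(\<Sum>p\<in>P. w (v p)) = (\<Sum>t\<in>v ` P. \<Sum>p\<in>{p\<in>P. v p = t}. w (v p))"
    by (rule sum.image_gen[OF assms])
  also have "\<dots> = (\<Sum>t\<in>v ` P. real (card {p\<in>P. v p = t}) * w t)"
    by (intro sum.cong) auto
  finally have "(\<Sum>p\<in>P. w (v p))\<^sup>2 \<le> (\<Sum>t\<in>v ` P. (real (card {p\<in>P. v p = t}))\<^sup>2) * (\<Sum>t\<in>v ` P. (w t)\<^sup>2)"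
    by (simp add: Cauchy_Schwarz_ineq_sum)
  also have "(\<Sum>t\<in>v ` P. (real (card {p\<in>P. v p = t}))\<^sup>2) = card (matches P v P v)"
    using card_matches[OF assms assms, of "v ` P" v v] assms by (simp add: power2_eq_square)
  finally show ?thesis .
qed

text \<open>The ordered \<open>m\<close>-tuples with entries in \<open>B\<close>.\<close>
definition tuples :: "'a set \<Rightarrow> nat \<Rightarrow> 'a list set" where
  "tuples B m = {x. length x = m \<and> set x \<subseteq> B}"

text \<open>An \<open>m\<close>-tuple together with a shift. The shifts turn an \<open>m\<close>-fold sum into the family of its translates by
  \<open>1, \<dots>, N\<close>, so that the number of points of value \<open>t\<close> counts the tuples whose sum lies in the window
  of length \<open>N\<close> just below \<open>t\<close>. Shifts start at \<open>1\<close> to keep all values positive.\<close>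
definition points :: "nat set \<Rightarrow> nat \<Rightarrow> nat \<Rightarrow> (nat list \<times> nat) set" where
  "points B N m = tuples B m \<times> {1..N}"

text \<open>The value of a point: the sum of its tuple plus its shift.\<close>
definition val :: "nat list \<times> nat \<Rightarrow> nat" where
  "val p = sum_list (fst p) + snd p"

text \<open>The additive energy: the number of pairs of points of equal value.\<close>
definition energy :: "nat set \<Rightarrow> nat \<Rightarrow> nat \<Rightarrow> nat" where
  "energy B N m = card (matches (points B N m) val (points B N m) val)"

lemma finite_tuples: "finite B \<Longrightarrow> finite (tuples B m)"
  using finite_lists_length_eq[of B m] by (simp add: tuples_def conj_commute)

lemma card_tuples: "finite B \<Longrightarrow> card (tuples B m) = card B ^ m"
  using card_lists_length_eq[of B m] by (simp add: tuples_def conj_commute)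

lemma finite_points: "finite B \<Longrightarrow> finite (points B N m)"
  by (simp add: points_def finite_tuples)

lemma energy_0: "energy B N 0 = N"
proof -
  have "matches (points B N 0) val (points B N 0) val = (\<lambda>i. (([], i), ([], i))) ` {1..N}"
    by (auto simp: matches_def points_def tuples_def val_def image_def)
  moreover have "inj_on (\<lambda>i. (([] :: nat list, i), ([] :: nat list, i))) {1..N}"
    by (auto simp: inj_on_def)
  ultimately show ?thesis by (simp add: energy_def card_image)
qed

text \<open>The energy of the \<open>(m + 1)\<close>-tuples counts the equations \<open>a + p = b + q\<close> with points \<open>p\<close>, \<open>q\<close> of
  \<open>m\<close>-tuples. Reading them as \<open>p = (b - a) + q\<close> and applying Cauchy-Schwarz to the families \<open>p\<close> and
  \<open>b - a + q\<close> gives log-convexity: two elements of the second family agree,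
  \<open>a - b + q = c - d + r\<close>, exactly when \<open>a + d + q = c + b + r\<close>.\<close>
lemma energy_log_convex:
  assumes B: "finite B"
  shows "(energy B N (Suc m))\<^sup>2 \<le> energy B N m * energy B N (Suc (Suc m))"
proof -
  define P where "P = points B N m"
  define Q where "Q = B \<times> B \<times> P"
  define v where "v = (\<lambda>p. int (val p))"
  define u where "u = (\<lambda>(a, b, p). int a - int b + int (val p))"
  have fin: "finite P" "finite Q" using B by (auto simp: P_def Q_def finite_points)
  define g :: "(nat list \<times> nat) \<times> (nat list \<times> nat) \<Rightarrow> _"
    where "g = (\<lambda>((x, i), (y, j)). ((tl x, i), (hd y, hd x, (tl y, j))))"
  have cases: "\<exists>a x i b y j. z = ((a # x, i), (b # y, j)) \<and> a \<in> B \<and> b \<in> B \<and> (x, i) \<in> P \<and> (y, j) \<in> P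
      \<and> a + val (x, i) = b + val (y, j)"
    if z: "z \<in> matches (points B N (Suc m)) val (points B N (Suc m)) val" for z
  proof -
    obtain x i y j where "z = ((x, i), (y, j))" by (metis prod.exhaust)
    thus ?thesis
      using z by (cases x; cases y) (auto simp: matches_def points_def tuples_def P_def val_def)
  qed
  have "energy B N (Suc m) \<le> card (matches P v Q u)"
    unfolding energy_def
  proof (rule card_inj_on_le[of g])
    show "inj_on g (matches (points B N (Suc m)) val (points B N (Suc m)) val)"
    proof (rule inj_onI)
      fix z z' assume z: "z \<in> matches (points B N (Suc m)) val (points B N (Suc m)) val"
        and z': "z' \<in> matches (points B N (Suc m)) val (points B N (Suc m)) val" and eq: "g z = g z'"
      show "z = z'" using cases[OF z] cases[OF z'] eq by (elim exE conjE) (simp add: g_def)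
    qed
    show "g ` matches (points B N (Suc m)) val (points B N (Suc m)) val \<subseteq> matches P v Q u"
    proof (rule image_subsetI)
      fix z assume z: "z \<in> matches (points B N (Suc m)) val (points B N (Suc m)) val"
      show "g z \<in> matches P v Q u"
        using cases[OF z]
        by (elim exE conjE) (simp add: g_def matches_def Q_def u_def v_def)
    qed
  qed (use fin finite_matches in auto)
  hence "(energy B N (Suc m))\<^sup>2 \<le> (card (matches P v Q u))\<^sup>2" by (rule power_mono) simp
  also have "\<dots> \<le> card (matches P v P v) * card (matches Q u Q u)"
    by (rule card_matches_square_le[OF fin])
  also have "card (matches P v P v) = energy B N m"
    by (simp add: energy_def matches_def v_def P_def)
  also have "card (matches Q u Q u) \<le> energy B N (Suc (Suc m))"
    unfolding energy_def
  proof (rule card_inj_on_le)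
    let ?g = "\<lambda>((a, b, x, i), (c, d, y, j)). ((a # d # x, i), (c # b # y, j))"
    show "inj_on ?g (matches Q u Q u)"
      by (rule inj_onI) (clarsimp split: prod.splits)
    show "?g ` matches Q u Q u
        \<subseteq> matches (points B N (Suc (Suc m))) val (points B N (Suc (Suc m))) val"
    proof (rule image_subsetI)
      fix z assume z: "z \<in> matches Q u Q u"
      obtain a b x i c d y j where z_eq: "z = ((a, b, x, i), (c, d, y, j))" by (metis prod.exhaust)
      have "int (a + d + val (x, i)) = int (c + b + val (y, j))"
        using z by (simp add: matches_def z_eq u_def)
      hence "a + d + val (x, i) = c + b + val (y, j)" by (simp only: of_nat_eq_iff)
      thus "?g z \<in> matches (points B N (Suc (Suc m))) val (points B N (Suc (Suc m))) val"
        using z by (simp add: z_eq matches_def points_def tuples_def P_def Q_def val_def)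
    qed
  qed (intro finite_matches finite_points B)
  finally show ?thesis by simp
qed

lemma card_lists_with_mset_le: "card {x. mset x = M} \<le> fact (size M)"
proof -
  have "card (permutations_of_multiset M) \<le> fact (size M)"
    by (subst card_permutations_of_multiset(1)) (rule div_le_dividend)
  thus ?thesis by (simp add: permutations_of_multiset_def)
qed

lemma Bh_set_mset_eq:
  assumes "is_Bh_set h A" "x \<in> tuples A h" "y \<in> tuples A h" "sum_list x = sum_list y"
  shows "mset x = mset y"
proof -
  have "sum_list (sort z) = sum_list z" for z :: "nat list"
    by (metis mset_sort sum_mset_sum_list)
  note sum_sort = this
  have "sort x = sort y"
  proof (rule inj_onD[of sum_list])
    show "inj_on sum_list {xs. length xs = h \<and> sorted xs \<and> set xs \<subseteq> A}"
      using assms(1) by (simp add: is_Bh_set_def)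
    show "sum_list (sort x) = sum_list (sort y)" using assms(4) by (simp add: sum_sort)
  qed (use assms(2,3) in \<open>simp_all add: tuples_def\<close>)
  thus ?thesis by (metis mset_sort)
qed

text \<open>Two disjoint pairs of tuples with the same difference agree up to order: \<open>x + y' = x' + y\<close> holds
  as multisets, and disjointness prevents any exchange between the two sides.\<close>
lemma Bh_set_disjoint_pairs:
  assumes Bh: "is_Bh_set (2 * k) A"
    and x: "x \<in> tuples A k" and y: "y \<in> tuples A k" and xy: "set x \<inter> set y = {}"
    and x': "x' \<in> tuples A k" and y': "y' \<in> tuples A k" and xy': "set x' \<inter> set y' = {}"
    and eq: "sum_list x + i = sum_list y + j" "sum_list x' + i = sum_list y' + j"
  shows "mset x = mset x' \<and> mset y = mset y'"
proof -
  have *: "mset (x @ y') = mset (x' @ y)"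
    by (rule Bh_set_mset_eq[OF Bh]) (use assms in \<open>auto simp: tuples_def\<close>)
  have "count (mset x) a = count (mset x') a \<and> count (mset y) a = count (mset y') a" for a
  proof -
    have "count (mset x) a + count (mset y') a = count (mset x') a + count (mset y) a"
      using arg_cong[OF *, of "\<lambda>M. count M a"] by simp
    moreover have "count (mset x) a = 0 \<or> count (mset y) a = 0" using xy by (auto simp: count_eq_zero_iff)
    moreover have "count (mset x') a = 0 \<or> count (mset y') a = 0" using xy' by (auto simp: count_eq_zero_iff)
    ultimately show ?thesis by linarith
  qed
  thus ?thesis by (simp add: multiset_eq_iff)
qed

lemma energy_le:
  assumes Bh: "is_Bh_set (2 * Suc m) A" and B: "finite B" "B \<subseteq> A"
  shows "energy B N (Suc m) \<le> (fact (Suc m))\<^sup>2 * N\<^sup>2 + (Suc m)\<^sup>2 * card B * energy B N m"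
proof -
  define k where "k = Suc m"
  define M where "M = matches (points B N k) val (points B N k) val"
  \<comment> \<open>\<open>D (i, j)\<close> collects the disjoint pairs of tuples. The map \<open>g\<close> inserts a common element \<open>a\<close> at the
    positions \<open>i\<close>, \<open>j\<close> of two tuples of length \<open>m\<close>, and so reaches all pairs that are not disjoint.\<close>
  define D where "D = (\<lambda>(i, j). {(x, y). x \<in> tuples B k \<and> y \<in> tuples B k \<and> set x \<inter> set y = {}
    \<and> sum_list x + i = sum_list y + j})"
  define R where "R = ({..<k} \<times> {..<k} \<times> B) \<times> matches (points B N m) val (points B N m) val"
  define g where "g = (\<lambda>((i, j, a), ((x :: nat list, s :: nat), (y :: nat list, t :: nat))).
    ((take i x @ a # drop i x, s), (take j y @ a # drop j y, t)))"
  define f where "f = (\<lambda>((i :: nat, j :: nat), (x :: nat list, y :: nat list)). ((x, i), (y, j)))"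
  have finD: "finite (D ij)" for ij
    by (rule finite_subset[of _ "tuples B k \<times> tuples B k"]) (use B finite_tuples in \<open>auto simp: D_def\<close>)
  have finR: "finite R"
    using B by (auto simp: R_def intro!: finite_matches finite_points)
  have sub: "M \<subseteq> f ` (SIGMA ij:{1..N} \<times> {1..N}. D ij) \<union> g ` R"
  proof
    fix z assume z: "z \<in> M"
    then obtain x i y j where z_eq: "z = ((x, i), (y, j))" by (metis prod.exhaust)
    have xy: "x \<in> tuples B k" "y \<in> tuples B k" "i \<in> {1..N}" "j \<in> {1..N}"
      "sum_list x + i = sum_list y + j"
      using z by (auto simp: z_eq M_def matches_def points_def val_def)
    show "z \<in> f ` (SIGMA ij:{1..N} \<times> {1..N}. D ij) \<union> g ` R"
    proof (cases "set x \<inter> set y = {}")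
      case True
      hence "((i, j), (x, y)) \<in> (SIGMA ij:{1..N} \<times> {1..N}. D ij)"
        using xy by (auto simp: D_def)
      hence "f ((i, j), (x, y)) \<in> f ` (SIGMA ij:{1..N} \<times> {1..N}. D ij)" by (rule imageI)
      thus ?thesis by (simp add: f_def z_eq)
    next
      case False
      then obtain a where "a \<in> set x" "a \<in> set y" by auto
      then obtain x1 x2 y1 y2 where s: "x = x1 @ a # x2" "y = y1 @ a # y2"
        by (meson split_list)
      let ?r = "((length x1, length y1, a), ((x1 @ x2, i), (y1 @ y2, j)))"
      have "?r \<in> R" using xy by (auto simp: R_def s tuples_def k_def matches_def points_def val_def)
      moreover have "g ?r = z" by (simp add: g_def z_eq s)
      ultimately show ?thesis by (metis UnI2 imageI)
    qed
  qed
  have "card (D ij) \<le> fact k * fact k" for ij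
  proof (cases "D ij = {}")
    case False
    obtain i j where ij: "ij = (i, j)" by fastforce
    from False obtain x0 y0 where 0: "(x0, y0) \<in> D ij" by auto
    have "D ij \<subseteq> {x. mset x = mset x0} \<times> {y. mset y = mset y0}"
    proof
      fix z assume z: "z \<in> D ij"
      obtain x y where z_eq: "z = (x, y)" by fastforce
      have tup: "w \<in> tuples A k" if "w \<in> tuples B k" for w using that B by (auto simp: tuples_def)
      have "mset x = mset x0 \<and> mset y = mset y0"
        by (rule Bh_set_disjoint_pairs[OF Bh[folded k_def], of _ _ _ _ i j])
           (use z 0 tup in \<open>auto simp: D_def z_eq ij\<close>)
      thus "z \<in> {x. mset x = mset x0} \<times> {y. mset y = mset y0}" by (simp add: z_eq)
    qed
    hence "card (D ij) \<le> card ({x. mset x = mset x0} \<times> {y. mset y = mset y0})"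
      using mset_eq_finite by (intro card_mono) auto
    also have "\<dots> \<le> fact (size (mset x0)) * fact (size (mset y0))"
      unfolding card_cartesian_product by (intro mult_mono card_lists_with_mset_le) auto
    also have "\<dots> = fact k * fact k" using 0 by (auto simp: D_def ij tuples_def)
    finally show ?thesis .
  qed simp
  hence "(\<Sum>ij\<in>{1..N} \<times> {1..N}. card (D ij)) \<le> (\<Sum>ij\<in>{1..N} \<times> {1..N}. fact k * fact k)"
    by (intro sum_mono)
  hence D_le: "card (SIGMA ij:{1..N} \<times> {1..N}. D ij) \<le> (fact k)\<^sup>2 * N\<^sup>2"
    using finD by (simp add: card_cartesian_product power2_eq_square algebra_simps)
  have "energy B N (Suc m) = card M" by (simp add: energy_def M_def k_def)
  also have "card M \<le> card (f ` (SIGMA ij:{1..N} \<times> {1..N}. D ij) \<union> g ` R)"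
    using finD finR sub by (intro card_mono) auto
  also have "\<dots> \<le> card (f ` (SIGMA ij:{1..N} \<times> {1..N}. D ij)) + card (g ` R)"
    by (rule card_Un_le)
  also have "\<dots> \<le> card (SIGMA ij:{1..N} \<times> {1..N}. D ij) + card R"
    using finD finR by (intro add_mono card_image_le) auto
  also have "card R = k\<^sup>2 * card B * energy B N m"
    by (simp add: R_def card_cartesian_product energy_def power2_eq_square)
  finally show ?thesis using D_le by (simp add: k_def)
qed

lemma card_Bh_set_power_le:
  assumes Bh: "is_Bh_set h A" and B: "B \<subseteq> A" "B \<subseteq> {..n}"
  shows "card B ^ h \<le> (h * n + 1) * fact h"
proof -
  have fin: "finite B" using B(2) by (rule finite_subset) simp
  have fib: "card {x \<in> tuples B h. sum_list x = t} \<le> fact h" for t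
  proof (cases "{x \<in> tuples B h. sum_list x = t} = {}")
    case False
    then obtain x0 where x0: "x0 \<in> tuples B h" "sum_list x0 = t" by auto
    have tup: "w \<in> tuples A h" if "w \<in> tuples B h" for w using that B by (auto simp: tuples_def)
    have "{x \<in> tuples B h. sum_list x = t} \<subseteq> {x. mset x = mset x0}"
      using Bh_set_mset_eq[OF Bh] x0 tup by auto
    hence "card {x \<in> tuples B h. sum_list x = t} \<le> card {x. mset x = mset x0}"
      by (rule card_mono[OF mset_eq_finite])
    also have "\<dots> \<le> fact (size (mset x0))" by (rule card_lists_with_mset_le)
    also have "size (mset x0) = h" using x0 by (simp add: tuples_def)
    finally show ?thesis .
  next
    case True
    show ?thesis unfolding True by simp
  qed
  have "sum_list x \<in> {..h * n}" if "x \<in> tuples B h" for x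
  proof -
    have "sum_list x \<le> (\<Sum>a\<leftarrow>x. n)"
      using that B sum_list_mono[of x "\<lambda>a. a" "\<lambda>a. n"] by (auto simp: tuples_def)
    thus ?thesis using that by (simp add: tuples_def sum_list_triv)
  qed
  hence "tuples B h = (\<Union>t\<in>{..h * n}. {x \<in> tuples B h. sum_list x = t})" by auto
  hence "card B ^ h = card (\<Union>t\<in>{..h * n}. {x \<in> tuples B h. sum_list x = t})"
    using card_tuples[OF fin] by metis
  also have "\<dots> \<le> (\<Sum>t\<in>{..h * n}. card {x \<in> tuples B h. sum_list x = t})"
    by (rule card_UN_le) simp
  also have "\<dots> \<le> (\<Sum>t\<in>{..h * n}. fact h)" by (intro sum_mono fib)
  finally show ?thesis by simp
qed

text \<open>If the ratio of consecutive energies is at least \<open>y\<close> at the last step, the first term on the right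
  suffices. Otherwise all earlier ratios are below \<open>y\<close> by log-convexity, and the second term suffices
  because the energy of the empty tuple is \<open>N\<close>.\<close>
lemma energy_absorb:
  fixes y :: real
  assumes B: "finite B" and y: "y \<ge> 0"
  shows "y * energy B N m \<le> real (energy B N (Suc m)) + y ^ Suc m * N"
proof (induction m)
  case 0
  then show ?case by (simp add: energy_0)
next
  case (Suc m)
  show ?case
  proof (cases "y = 0")
    case False
    hence y: "y > 0" using assms(2) by simp
    define e0 e1 e2 where "e0 = real (energy B N m)" and "e1 = real (energy B N (Suc m))"
      and "e2 = real (energy B N (Suc (Suc m)))"
    have lc: "e1\<^sup>2 \<le> e0 * e2"
      using energy_log_convex[OF B, of N m] unfolding e0_def e1_def e2_def
      by (metis of_nat_le_iff of_nat_mult of_nat_power)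
    have IH: "y * e0 \<le> e1 + y ^ Suc m * N" using Suc by (simp add: e0_def e1_def)
    have nn: "e0 \<ge> 0" "e1 \<ge> 0" "e2 \<ge> 0" by (auto simp: e0_def e1_def e2_def)
    have "y * e1 - e2 \<le> y * (y ^ Suc m * N)"
    proof (cases "e0 > 0 \<and> e1 \<le> y * e0")
      case True
      have "y * e1 - e2 \<le> e1 / e0 * (y * e0 - e1)"
        using lc True by (simp add: field_simps power2_eq_square)
      also have "\<dots> \<le> y * (y * e0 - e1)"
        using True by (intro mult_right_mono) (auto simp: field_simps)
      also have "\<dots> \<le> y * (y ^ Suc m * N)"
        using IH y by (intro mult_left_mono) auto
      finally show ?thesis .
    next
      case False
      have "y * e1 \<le> e2"
      proof (cases "e1 > 0")
        case e1: True
        have "e0 > 0"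
          using lc e1 nn by (metis less_eq_real_def mult_zero_left not_less zero_less_power)
        hence "y * e0 \<le> e1" using False by simp
        have "y * e1\<^sup>2 \<le> y * (e0 * e2)" using lc y by simp
        also have "\<dots> = y * e0 * e2" by simp
        also have "\<dots> \<le> e1 * e2" using \<open>y * e0 \<le> e1\<close> nn by (intro mult_right_mono)
        finally have "e1 * (y * e1) \<le> e1 * e2" by (simp add: power2_eq_square mult_ac)
        thus ?thesis using e1 by simp
      qed (use nn in auto)
      moreover have "0 \<le> y * (y ^ Suc m * N)" using y by simp
      ultimately show ?thesis by linarith
    qed
    thus ?thesis by (simp add: e1_def e2_def mult_ac)
  qed simp
qed

text \<open>The solutions in which the two tuples share an element are absorbed at the cost of the factor
  \<open>1 - d\<close>, by applying \<open>energy_absorb\<close> with \<open>y = k\<^sup>2 * card B / d\<close>.\<close>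
lemma energy_upper_bound:
  fixes d :: real
  assumes Bh: "is_Bh_set (2 * k) A" and k: "k > 0" and B: "finite B" "B \<subseteq> A" and d: "d > 0"
  shows "(1 - d) * energy B N k
    \<le> (fact k)\<^sup>2 * (real N)\<^sup>2 + d * (real (k\<^sup>2) / d) ^ k * real (card B) ^ k * real N"
proof -
  obtain m where m: "k = Suc m" using k by (cases k) auto
  define y where "y = real (k\<^sup>2) / d * real (card B)"
  have y: "y \<ge> 0" using d by (simp add: y_def)
  have "real (energy B N k) \<le> real ((fact k)\<^sup>2 * N\<^sup>2 + k\<^sup>2 * card B * energy B N m)"
    using energy_le[of m A B N] Bh B by (simp only: m of_nat_le_iff)
  also have "\<dots> = (fact k)\<^sup>2 * (real N)\<^sup>2 + d * (y * energy B N m)"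
    using d by (simp add: y_def)
  also have "\<dots> \<le> (fact k)\<^sup>2 * (real N)\<^sup>2 + d * (energy B N k + y ^ k * N)"
    using energy_absorb[OF B(1) y, of N m] d by (simp add: m)
  finally show ?thesis by (simp add: y_def power_mult_distrib power_divide algebra_simps)
qed

section \<open>The Laplace transform and Hilbert's inequality\<close>

lemma Cauchy_Schwarz_integral:
  fixes f g :: "real \<Rightarrow> real"
  assumes f: "continuous_on {a..b} f" and g: "continuous_on {a..b} g"
  shows "(integral {a..b} (\<lambda>x. f x * g x))\<^sup>2
    \<le> integral {a..b} (\<lambda>x. (f x)\<^sup>2) * integral {a..b} (\<lambda>x. (g x)\<^sup>2)"
proof -
  define F G H where "F = integral {a..b} (\<lambda>x. (f x)\<^sup>2)" and "G = integral {a..b} (\<lambda>x. (g x)\<^sup>2)"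
    and "H = integral {a..b} (\<lambda>x. f x * g x)"
  have int: "(\<lambda>x. (f x)\<^sup>2) integrable_on {a..b}" "(\<lambda>x. (g x)\<^sup>2) integrable_on {a..b}"
    "(\<lambda>x. f x * g x) integrable_on {a..b}"
    by (intro integrable_continuous_real continuous_intros f g)+
  have *: "0 \<le> p\<^sup>2 * F - 2 * p * q * H + q\<^sup>2 * G" for p q
  proof -
    have "((\<lambda>x. p\<^sup>2 * (f x)\<^sup>2 - 2 * p * q * (f x * g x) + q\<^sup>2 * (g x)\<^sup>2)
        has_integral (p\<^sup>2 * F - 2 * p * q * H + q\<^sup>2 * G)) {a..b}"
      unfolding F_def G_def H_def
      by (intro has_integral_add has_integral_diff has_integral_mult_right integrable_integral int)
    moreover have "0 \<le> p\<^sup>2 * (f x)\<^sup>2 - 2 * p * q * (f x * g x) + q\<^sup>2 * (g x)\<^sup>2" for x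
    proof -
      have "p\<^sup>2 * (f x)\<^sup>2 - 2 * p * q * (f x * g x) + q\<^sup>2 * (g x)\<^sup>2 = (p * f x - q * g x)\<^sup>2"
        by (simp add: power2_eq_square algebra_simps)
      thus ?thesis by simp
    qed
    ultimately show ?thesis by (rule has_integral_nonneg)
  qed
  have G0: "G \<ge> 0" unfolding G_def using int by (intro integral_nonneg) auto
  show ?thesis unfolding F_def[symmetric] G_def[symmetric] H_def[symmetric]
  proof (cases "G = 0")
    case False
    hence "G > 0" using G0 by simp
    have "0 \<le> G\<^sup>2 * F - 2 * G * H * H + H\<^sup>2 * G" by (rule *)
    also have "\<dots> = G * (F * G - H\<^sup>2)" by (simp add: power2_eq_square algebra_simps)
    finally show "H\<^sup>2 \<le> F * G" using \<open>G > 0\<close> by (simp add: zero_le_mult_iff)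
  next
    case True
    have "0 \<le> 1\<^sup>2 * F - 2 * 1 * q * H + q\<^sup>2 * G" for q by (rule *)
    \<comment> \<open>The form is affine in \<open>q\<close> here; this \<open>q\<close> makes it equal to \<open>- 1\<close> unless \<open>H = 0\<close>.\<close>
    from this[of "(F + 1) / (2 * H)"] have "H = 0" using True by (cases "H = 0") auto
    thus "H\<^sup>2 \<le> F * G" by (simp add: True)
  qed
qed

text \<open>The integrand of \<open>Gamma (1 / 2) = sqrt pi\<close>. At \<open>0\<close> it takes the value \<open>0\<close>, so it is decreasing on the
  positive reals only.\<close>
definition gker :: "real \<Rightarrow> real" where "gker u = u powr (- 1 / 2) / exp u"

lemma gker_has_integral: "(gker has_integral sqrt pi) {0..}"
proof -
  have "gker = (\<lambda>t. t powr (1 / 2 - 1) / exp t)" by (simp add: fun_eq_iff gker_def)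
  thus ?thesis using Gamma_integral_real[of "1 / 2"] by (simp add: Gamma_one_half_real)
qed

lemma gker_nonneg: "gker u \<ge> 0"
  by (simp add: gker_def)

lemma gker_antimono: "0 < u \<Longrightarrow> u \<le> v \<Longrightarrow> gker v \<le> gker u"
  unfolding gker_def by (intro frac_le powr_mono2') auto

lemma gker_integrable: "0 \<le> a \<Longrightarrow> gker integrable_on {a..b}"
  using gker_has_integral by (intro integrable_on_subinterval[of _ "{0..}"]) (auto simp: has_integral_iff)

lemma gker_integral_le: "0 \<le> a \<Longrightarrow> integral {a..b} gker \<le> sqrt pi"
  using gker_has_integral gker_integrable[of a b] gker_nonneg
    integral_subset_le[of "{a..b}" "{0..}" gker] by (auto simp: has_integral_iff)

lemma gker_scaled:
  assumes "t > 0" "s > 0"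
  shows "s powr (- 1 / 2) * exp (- (t * s)) = sqrt t * gker (t * s)"
  using assms by (auto simp: gker_def powr_mult powr_minus powr_half_sqrt exp_minus field_simps)

lemma integral_gker_scaled_le:
  assumes t: "t > 0" and a: "0 < a" "a \<le> b"
  shows "integral {a..b} (\<lambda>s. s powr (- 1 / 2) * exp (- (t * s))) \<le> sqrt (pi / t)"
proof -
  have "(gker has_integral integral {t * a..t * b} gker) (cbox (t * a) (t * b))"
    using t a gker_integrable[of "t * a" "t * b"] by (simp add: integrable_integral)
  from has_integral_affinity[OF this, of t 0]
  have "((\<lambda>s. gker (t * s)) has_integral (integral {t * a..t * b} gker / t)) {a..b}"
    using t a by (simp add: field_simps image_mult_atLeastAtMost)
  hence "((\<lambda>s. sqrt t * gker (t * s)) has_integral (sqrt t * (integral {t * a..t * b} gker / t))) {a..b}"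
    by (rule has_integral_mult_right)
  hence "integral {a..b} (\<lambda>s. sqrt t * gker (t * s)) = sqrt t * (integral {t * a..t * b} gker / t)"
    by (rule integral_unique)
  also have "\<dots> \<le> sqrt t * (sqrt pi / t)"
    using t a gker_integral_le[of "t * a" "t * b"] by (intro mult_left_mono divide_right_mono) auto
  also have "\<dots> = sqrt (pi / t)"
    using t by (simp add: real_sqrt_divide field_simps)
  also have "integral {a..b} (\<lambda>s. sqrt t * gker (t * s))
      = integral {a..b} (\<lambda>s. s powr (- 1 / 2) * exp (- (t * s)))"
    using t a by (intro integral_cong gker_scaled[symmetric]) auto
  finally show ?thesis .
qed

lemma sum_gker_le:
  assumes s: "s > 0"
  shows "(\<Sum>t=1..M. s * gker (real t * s)) \<le> integral {0..real M * s} gker"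
proof (induction M)
  case (Suc M)
  let ?a = "real M * s" and ?b = "real (Suc M) * s"
  have ab: "0 \<le> ?a" "?a \<le> ?b" "?b - ?a = s" using s by (auto simp: algebra_simps)
  have "((\<lambda>u. gker ?b) has_integral (s * gker ?b)) {?a..?b}"
    using has_integral_const_real[of "gker ?b" ?a ?b] ab by (simp add: content_real)
  \<comment> \<open>The default value \<open>gker 0 = 0\<close> would break the pointwise comparison at \<open>u = 0\<close>.\<close>
  hence "((\<lambda>u. if u = 0 then 0 else gker ?b) has_integral (s * gker ?b)) {?a..?b}"
    by (rule has_integral_spike[of "{0}", rotated 2]) auto
  moreover have "(gker has_integral integral {?a..?b} gker) {?a..?b}"
    using gker_integrable ab by (intro integrable_integral) auto
  ultimately have "s * gker ?b \<le> integral {?a..?b} gker"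
  proof (rule has_integral_le)
    fix u assume u: "u \<in> {?a..?b}"
    show "(if u = 0 then 0 else gker ?b) \<le> gker u"
    proof (cases "u = 0")
      case False
      moreover have "0 \<le> u" using u ab(1) by (meson atLeastAtMost_iff order_trans)
      ultimately have "0 < u" by simp
      thus ?thesis using u gker_antimono[of u ?b] False by simp
    qed (simp add: gker_nonneg)
  qed
  moreover have "integral {0..?a} gker + integral {?a..?b} gker = integral {0..?b} gker"
    using ab gker_integrable by (intro Henstock_Kurzweil_Integration.integral_combine) auto
  ultimately show ?case using Suc by simp
qed simp

lemma sum_exp_over_sqrt_le:
  assumes s: "s > 0" and S: "finite S" "0 \<notin> S"
  shows "(\<Sum>t\<in>S. exp (- (real t * s)) / sqrt (real t)) \<le> sqrt (pi / s)"
proof -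
  have sub: "S \<subseteq> {1..Max S}"
  proof
    fix t assume "t \<in> S"
    thus "t \<in> {1..Max S}" using S by (cases t) auto
  qed
  have eq: "exp (- (real t * s)) / sqrt (real t) = s * gker (real t * s) / sqrt s" if "t \<ge> 1" for t :: nat
    using that s by (simp add: gker_def powr_mult powr_minus powr_half_sqrt exp_minus field_simps)
  have "(\<Sum>t\<in>S. exp (- (real t * s)) / sqrt (real t))
      \<le> (\<Sum>t=1..Max S. exp (- (real t * s)) / sqrt (real t))"
    using sub by (intro sum_mono2) auto
  also have "\<dots> = (\<Sum>t=1..Max S. s * gker (real t * s)) / sqrt s"
    unfolding sum_divide_distrib by (intro sum.cong refl eq) auto
  also have "\<dots> \<le> sqrt pi / sqrt s"
    using sum_gker_le[OF s, of "Max S"] gker_integral_le[of 0 "real (Max S) * s"] s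
    by (intro divide_right_mono) auto
  finally show ?thesis by (simp add: real_sqrt_divide)
qed

text \<open>A discrete form of the bound \<open>sqrt pi\<close> for the norm of the Laplace transform on \<open>L\<^sup>2\<close>, which is
  equivalent to Hilbert's inequality. As in Schur's test, Cauchy-Schwarz is applied to the factorisation
  of \<open>w s * exp (- t * s)\<close> into \<open>w s * s powr (1 / 4) * exp (- t * s / 2)\<close> and
  \<open>s powr (- 1 / 4) * exp (- t * s / 2)\<close>; the integral over \<open>s\<close> and the sum over \<open>t\<close> that then
  arise are both controlled by \<open>Gamma (1 / 2)\<close>.\<close>
lemma sum_Laplace_square_le:
  fixes w :: "real \<Rightarrow> real"
  assumes a: "0 < a" "a \<le> b" and w: "continuous_on {a..b} w" and S: "finite S" "0 \<notin> S"
  shows "(\<Sum>t\<in>S. (integral {a..b} (\<lambda>s. w s * exp (- (real t * s))))\<^sup>2)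
    \<le> pi * integral {a..b} (\<lambda>s. (w s)\<^sup>2)"
proof -
  define F where "F t s = (w s)\<^sup>2 * sqrt s * exp (- (real t * s))" for t :: nat and s
  have F_int: "F t integrable_on {a..b}" for t
    unfolding F_def by (intro integrable_continuous_real continuous_intros w)
  have "(integral {a..b} (\<lambda>s. w s * exp (- (real t * s))))\<^sup>2 \<le> integral {a..b} (F t) * sqrt (pi / t)"
    if t: "t \<in> S" for t
  proof -
    have t0: "real t > 0" using t S by (cases t) auto
    define f where "f s = w s * s powr (1 / 4) * exp (- (real t * s) / 2)" for s
    define g where "g s = s powr (- 1 / 4) * exp (- (real t * s) / 2)" for s :: real
    have e: "exp (- (x / 2)) * exp (- (x / 2)) = exp (- x)" for x :: real
      by (simp flip: exp_add)
    have pw: "s powr (1 / 4) * s powr (- 1 / 4) = 1" "(s powr (1 / 4))\<^sup>2 = sqrt s"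
      "(s powr (- 1 / 4))\<^sup>2 = s powr (- 1 / 2)" if "s > 0" for s :: real
      using that by (auto simp: powr_half_sqrt[symmetric] power2_eq_square simp flip: powr_add)
    have "(integral {a..b} (\<lambda>s. f s * g s))\<^sup>2
      \<le> integral {a..b} (\<lambda>s. (f s)\<^sup>2) * integral {a..b} (\<lambda>s. (g s)\<^sup>2)"
      unfolding f_def g_def using a
      by (intro Cauchy_Schwarz_integral continuous_intros w) auto
    also have "integral {a..b} (\<lambda>s. f s * g s) = integral {a..b} (\<lambda>s. w s * exp (- (real t * s)))"
    proof (rule integral_cong)
      fix s assume "s \<in> {a..b}"
      hence "s > 0" using a by auto
      have "f s * g s = w s * (s powr (1 / 4) * s powr (- 1 / 4))
          * (exp (- (real t * s / 2)) * exp (- (real t * s / 2)))"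
        by (simp add: f_def g_def)
      thus "f s * g s = w s * exp (- (real t * s))" by (simp only: pw(1)[OF \<open>s > 0\<close>] e mult_1_right)
    qed
    also have "integral {a..b} (\<lambda>s. (f s)\<^sup>2) = integral {a..b} (F t)"
    proof (rule integral_cong)
      fix s assume "s \<in> {a..b}"
      hence "s > 0" using a by auto
      have "(f s)\<^sup>2 = (w s)\<^sup>2 * (s powr (1 / 4))\<^sup>2
          * (exp (- (real t * s / 2)) * exp (- (real t * s / 2)))"
        by (simp add: f_def power2_eq_square)
      thus "(f s)\<^sup>2 = F t s" by (simp only: pw(2)[OF \<open>s > 0\<close>] e F_def)
    qed
    also have "integral {a..b} (\<lambda>s. (g s)\<^sup>2)
        = integral {a..b} (\<lambda>s. s powr (- 1 / 2) * exp (- (real t * s)))"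
    proof (rule integral_cong)
      fix s assume "s \<in> {a..b}"
      hence "s > 0" using a by auto
      have "(g s)\<^sup>2 = (s powr (- 1 / 4))\<^sup>2
          * (exp (- (real t * s / 2)) * exp (- (real t * s / 2)))"
        by (simp add: g_def power2_eq_square)
      thus "(g s)\<^sup>2 = s powr (- 1 / 2) * exp (- (real t * s))" by (simp only: pw(3)[OF \<open>s > 0\<close>] e)
    qed
    finally have "(integral {a..b} (\<lambda>s. w s * exp (- (real t * s))))\<^sup>2
      \<le> integral {a..b} (F t) * integral {a..b} (\<lambda>s. s powr (- 1 / 2) * exp (- (real t * s)))" .
    also have "\<dots> \<le> integral {a..b} (F t) * sqrt (pi / t)"
      using a t0 F_int
      by (intro mult_left_mono integral_gker_scaled_le integral_nonneg) (auto simp: F_def)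
    finally show ?thesis .
  qed
  hence "(\<Sum>t\<in>S. (integral {a..b} (\<lambda>s. w s * exp (- (real t * s))))\<^sup>2)
      \<le> (\<Sum>t\<in>S. integral {a..b} (\<lambda>s. F t s * sqrt (pi / t)))"
    by (intro sum_mono) simp
  also have "\<dots> = integral {a..b} (\<lambda>s. \<Sum>t\<in>S. F t s * sqrt (pi / t))"
    using F_int by (intro integral_sum[symmetric] integrable_on_mult_left S) auto
  also have "\<dots> \<le> integral {a..b} (\<lambda>s. pi * (w s)\<^sup>2)"
  proof (rule integral_le)
    show "(\<lambda>s. \<Sum>t\<in>S. F t s * sqrt (pi / real t)) integrable_on {a..b}"
      using F_int by (intro integrable_sum integrable_on_mult_left S) auto
    show "(\<lambda>s. pi * (w s)\<^sup>2) integrable_on {a..b}"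
      by (intro integrable_continuous_real continuous_intros w)
    fix s assume "s \<in> {a..b}"
    hence s: "s > 0" using a by auto
    have "(\<Sum>t\<in>S. F t s * sqrt (pi / real t))
        = (w s)\<^sup>2 * sqrt s * sqrt pi * (\<Sum>t\<in>S. exp (- (real t * s)) / sqrt (real t))"
      unfolding sum_distrib_left by (intro sum.cong) (auto simp: F_def real_sqrt_divide)
    also have "\<dots> \<le> (w s)\<^sup>2 * sqrt s * sqrt pi * sqrt (pi / s)"
      using s by (intro mult_left_mono sum_exp_over_sqrt_le S) auto
    also have "\<dots> = pi * (w s)\<^sup>2" using s by (simp add: real_sqrt_divide)
    finally show "(\<Sum>t\<in>S. F t s * sqrt (pi / real t)) \<le> pi * (w s)\<^sup>2" .
  qed
  finally show ?thesis by simp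
qed

section \<open>Exponential sums over sets with a dense counting function\<close>

lemma Gamma_integral_truncated:
  fixes p g :: real
  assumes p: "p > 0" and g: "g < Gamma (1 + p)"
  obtains a L where "0 < a" "a < L" "g < integral {a..L} (\<lambda>y. y powr p * exp (- y))"
proof -
  define e where "e = (Gamma (1 + p) - g) / 2"
  have e: "e > 0" using g by (simp add: e_def)
  define f where "f y = y powr p * exp (- y)" for y :: real
  have "(f has_integral Gamma (1 + p)) {0..}"
    using Gamma_integral_real[of "1 + p"] p by (simp add: f_def[abs_def] exp_minus divide_inverse)
  then obtain B where B: "B > 0" and
    "\<And>a b. ball 0 B \<subseteq> cbox a b \<Longrightarrow> \<exists>z. ((\<lambda>x. if x \<in> {0..} then f x else 0) has_integral z) (cbox a b)
      \<and> norm (z - Gamma (1 + p)) < e"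
    using e unfolding has_integral_alt'[of f] by (auto simp: has_integral_iff)
  moreover have "ball 0 B \<subseteq> cbox (- B) B" by (auto simp: dist_real_def)
  ultimately obtain z where
    z: "((\<lambda>x. if x \<in> {0..} then f x else 0) has_integral z) {-B..B}" "norm (z - Gamma (1 + p)) < e"
    by (metis box_real(2))
  have z': "(f has_integral z) {0..B}"
  proof -
    have "(f has_integral z) ({0..} \<inter> {-B..B})"
      using z(1) by (subst has_integral_restrict_Int[symmetric]) simp
    also have "{0..} \<inter> {-B..B} = {0..B}" using B by auto
    finally show ?thesis .
  qed
  define F where "F a = integral {0..a} f" for a
  have "continuous_on {0..B} F"
    unfolding F_def using z' by (intro indefinite_integral_continuous_1) (auto simp: has_integral_iff)
  hence "(F \<longlongrightarrow> F 0) (at 0 within {0..B})" using B by (simp add: continuous_on)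
  hence "(F \<longlongrightarrow> 0) (at_right 0)" using B by (simp add: at_within_Icc_at_right F_def)
  hence "eventually (\<lambda>a. F a < e) (at_right 0)" using e by (rule order_tendstoD(2))
  moreover have "eventually (\<lambda>a. a < B \<and> a > 0) (at_right 0)"
    using B by (auto simp: eventually_at_right_field intro!: exI[of _ B])
  ultimately have "eventually (\<lambda>a. F a < e \<and> a < B \<and> a > 0) (at_right 0)" by eventually_elim auto
  then obtain a where a: "F a < e" "a < B" "a > 0"
    using eventually_happens[of _ "at_right (0::real)"] by (auto simp: trivial_limit_at_right_real)
  have "integral {0..a} f + integral {a..B} f = integral {0..B} f"
    using a z' by (intro Henstock_Kurzweil_Integration.integral_combine) (auto simp: has_integral_iff)
  moreover have "integral {0..B} f = z" using z' by (rule integral_unique)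
  moreover have "2 * e = Gamma (1 + p) - g" by (simp add: e_def)
  moreover have "Gamma (1 + p) - z < e" using z(2) by (simp add: abs_less_iff)
  moreover have "integral {0..a} f < e" using a(1) by (simp add: F_def)
  ultimately have "g < integral {a..B} f" by linarith
  thus ?thesis using a that by (simp add: f_def[abs_def])
qed

text \<open>Partial summation in integral form: \<open>exp (- b * s)\<close> is the integral of \<open>exp (- y)\<close> over
  \<open>y \<ge> b * s\<close>, so the sum over \<open>b\<close> is at least the integral over \<open>{a..L}\<close> of \<open>exp (- y)\<close> times the number of
  \<open>b \<le> y / s\<close>.\<close>
lemma counting_sum_le_exp_sum:
  fixes s a L c K p :: real and B :: "nat set"
  assumes fin: "finite B" and a: "0 < a" "a \<le> L" and p: "p > 0"
    and count: "\<And>y. a \<le> y \<Longrightarrow> y \<le> L \<Longrightarrow> c * y powr p \<le> card {b \<in> B. real b * s \<le> y}"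
    and s: "s > 0"
  shows "c * integral {a..L} (\<lambda>y. y powr p * exp (- y)) \<le> (\<Sum>b\<in>B. exp (- (real b * s)))"
proof -
  define I where "I b = (if real b * s \<le> L then exp (- max a (real b * s)) - exp (- L) else 0)" for b :: nat
  have exp_int: "((\<lambda>y. exp (- y)) has_integral exp (- l) - exp (- u)) {l..u}" if "l \<le> u" for l u :: real
  proof -
    have "((\<lambda>y. - exp (- y)) has_vector_derivative exp (- y)) (at y within {l..u})" for y :: real
      unfolding has_real_derivative_iff_has_vector_derivative[symmetric]
      by (auto intro!: derivative_eq_intros)
    from fundamental_theorem_of_calculus[OF that this] show ?thesis by simp
  qed
  have I: "((\<lambda>y. if real b * s \<le> y then exp (- y) else 0) has_integral I b) {a..L}" for b
  proof (cases "real b * s \<le> L")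
    case True
    have "((\<lambda>y. exp (- y)) has_integral I b) ({real b * s..} \<inter> {a..L})"
    proof -
      have "{real b * s..} \<inter> {a..L} = {max a (real b * s)..L}" by auto
      thus ?thesis using exp_int[of "max a (real b * s)" L] True a by (simp add: I_def)
    qed
    thus ?thesis by (subst (asm) has_integral_restrict_Int[symmetric]) simp
  next
    case False
    hence "((\<lambda>y. if real b * s \<le> y then exp (- y) else 0) has_integral 0) {a..L}"
      by (intro has_integral_is_0) auto
    thus ?thesis using False by (simp add: I_def)
  qed
  have sum_I: "((\<lambda>y. \<Sum>b\<in>B. if real b * s \<le> y then exp (- y) else 0) has_integral (\<Sum>b\<in>B. I b)) {a..L}"
    by (intro has_integral_sum fin I)
  have "(\<lambda>y. y powr p * exp (- y)) integrable_on {a..L}"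
    using a by (intro integrable_continuous_real continuous_intros) auto
  hence "((\<lambda>y. c * (y powr p * exp (- y))) has_integral
      (c * integral {a..L} (\<lambda>y. y powr p * exp (- y)))) {a..L}"
    by (intro has_integral_mult_right integrable_integral)
  hence "c * integral {a..L} (\<lambda>y. y powr p * exp (- y)) \<le> (\<Sum>b\<in>B. I b)"
  proof (rule has_integral_le[OF _ sum_I])
    fix y assume y: "y \<in> {a..L}"
    have "c * (y powr p * exp (- y)) \<le> card {b \<in> B. real b * s \<le> y} * exp (- y)"
      using count[of y] y by (simp add: mult.assoc[symmetric] mult_right_mono)
    also have "\<dots> = (\<Sum>b\<in>B. if real b * s \<le> y then exp (- y) else 0)"
      using fin by (simp add: sum.If_cases Int_def)
    finally show "c * (y powr p * exp (- y)) \<le> (\<Sum>b\<in>B. if real b * s \<le> y then exp (- y) else 0)" .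
  qed
  also have "(\<Sum>b\<in>B. I b) \<le> (\<Sum>b\<in>B. exp (- (real b * s)))"
  proof (rule sum_mono)
    fix b
    have "exp (- max a (real b * s)) \<le> exp (- (real b * s))" by simp
    moreover have "exp (- L) > 0" by simp
    moreover have "I b = exp (- max a (real b * s)) - exp (- L) \<or> I b = 0" by (simp add: I_def)
    moreover have "exp (- (real b * s)) > 0" by simp
    ultimately show "I b \<le> exp (- (real b * s))" by linarith
  qed
  finally show ?thesis .
qed

text \<open>An Abelian estimate: a lower bound for the counting function yields one for the exponential sum near
  \<open>s = 0\<close>. Only the elements up to \<open>L / s\<close> matter, with \<open>L\<close> depending on how close \<open>g\<close> is to
  \<open>c * Gamma (1 + p)\<close>.\<close>
lemma exp_sum_lower_bound:
  fixes A :: "nat set" and c g p :: real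
  assumes p: "p > 0" and c: "c > 0" and g: "0 < g" "g < c * Gamma (1 + p)"
    and count: "eventually (\<lambda>n. c * (real n / ln (real n)) powr p \<le> counting_fun A n) sequentially"
  obtains L where "L > 0"
    "eventually (\<lambda>s. \<forall>\<tau>\<ge>L / s. g * (1 / (s * ln (1 / s))) powr p \<le> (\<Sum>b | b \<in> A \<and> real b \<le> \<tau>. exp (- (real b * s))))
      (at_right 0)"
proof -
  from g c have "g / c < Gamma (1 + p)" by (simp add: field_simps)
  then obtain a L where aL: "0 < a" "a < L" "g / c < integral {a..L} (\<lambda>y. y powr p * exp (- y))"
    using Gamma_integral_truncated[OF p] by blast
  have L0: "L > 0" using aL by simp
  define J where "J = integral {a..L} (\<lambda>y. y powr p * exp (- y))"
  have J: "c * J > g" using aL c by (simp add: J_def field_simps)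
  hence "J > 0" using g c by (metis less_trans zero_less_mult_pos)
  obtain n0 where n0: "\<And>n. n \<ge> n0 \<Longrightarrow> c * (real n / ln (real n)) powr p \<le> counting_fun A n"
    using count by (auto simp: eventually_sequentially)
  define K where "K s = (1 - s / a) / (s * ln (L / s))" for s
  have "((\<lambda>s. c * J * ((1 - s / a) * (ln (1 / s) / ln (L / s))) powr p) \<longlongrightarrow> c * J * (1 * 1) powr p) (at_right 0)"
  proof (intro tendsto_intros)
    show "((\<lambda>s. 1 - s / a) \<longlongrightarrow> 1) (at_right 0)" using aL(1) by real_asymp
    show "((\<lambda>s. ln (1 / s) / ln (L / s)) \<longlongrightarrow> 1) (at_right 0)" using L0 by real_asymp
  qed auto
  hence "eventually (\<lambda>s. g < c * J * ((1 - s / a) * (ln (1 / s) / ln (L / s))) powr p) (at_right 0)"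
    using J by (intro order_tendstoD(1)[of _ "c * J * (1 * 1) powr p"]) auto
  moreover have "eventually (\<lambda>s. a / s - 1 \<ge> real n0) (at_right 0)"
    using aL(1) by real_asymp
  moreover have "eventually (\<lambda>s. a / s - 1 \<ge> 2) (at_right 0)"
    using aL(1) by real_asymp
  moreover have "eventually (\<lambda>s. 0 < s \<and> s < 1 \<and> s < a) (at_right 0)"
    using aL(1) by (auto simp: eventually_at_right_field intro!: exI[of _ "min 1 a"])
  ultimately have ev: "eventually (\<lambda>s. \<forall>\<tau>\<ge>L / s. g * (1 / (s * ln (1 / s))) powr p
    \<le> (\<Sum>b | b \<in> A \<and> real b \<le> \<tau>. exp (- (real b * s)))) (at_right 0)"
  proof eventually_elim
    case (elim s)
    hence s: "0 < s" "s < 1" "s < a" by auto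
    have "L / s > a / s" using aL s by (simp add: divide_strict_right_mono)
    hence Ls: "L / s > 3" using elim by linarith
    hence lnLs: "ln (L / s) > 0" by simp
    have ln1s: "ln (1 / s) > 0" using s by simp
    have K: "K s > 0" using s lnLs aL by (simp add: K_def)
    show ?case
    proof (intro allI impI)
      fix \<tau> assume \<tau>: "L / s \<le> \<tau>"
      define B where "B = {b. b \<in> A \<and> real b \<le> \<tau>}"
      have fin: "finite B"
        by (rule finite_subset[of _ "{..nat \<lfloor>\<tau>\<rfloor>}"]) (auto simp: B_def le_nat_floor)
      have "g * (1 / (s * ln (1 / s))) powr p
          \<le> c * J * ((1 - s / a) * (ln (1 / s) / ln (L / s))) powr p * (1 / (s * ln (1 / s))) powr p"
        using elim by (intro mult_right_mono) auto
      also have "\<dots> = c * J * (((1 - s / a) * (ln (1 / s) / ln (L / s))) * (1 / (s * ln (1 / s)))) powr p"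
        using s lnLs ln1s by (subst powr_mult) auto
      also have "((1 - s / a) * (ln (1 / s) / ln (L / s))) * (1 / (s * ln (1 / s))) = K s"
        using s lnLs ln1s by (simp add: K_def)
      also have "c * J * K s powr p = c * K s powr p * J" by simp
      also have "\<dots> \<le> (\<Sum>b\<in>B. exp (- (real b * s)))"
        unfolding J_def
      proof (rule counting_sum_le_exp_sum[OF fin])
        fix y assume y: "a \<le> y" "y \<le> L"
        \<comment> \<open>All integers below \<open>n\<close> satisfy \<open>b * s \<le> y\<close>. The factor \<open>1 - s / a\<close> in \<open>K s\<close> pays for rounding
          \<open>y / s\<close> down, and \<open>ln n\<close> is at most \<open>ln (L / s)\<close>.\<close>
        define n where "n = nat \<lfloor>y / s\<rfloor>"
        have ys: "a / s \<le> y / s" "y / s \<le> L / s" using y s by (auto simp: divide_right_mono)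
        hence n: "real n \<le> y / s" "y / s - 1 \<le> real n" using elim unfolding n_def by linarith+
        have n_ge: "real n \<ge> 2" "n \<ge> n0" using n ys elim by linarith+
        have "y * K s * ln (real n) \<le> y * K s * ln (L / s)"
          using n_ge n ys y aL K by (intro mult_left_mono) auto
        also have "\<dots> = y / s - y / a" using lnLs aL s by (simp add: K_def field_simps)
        also have "\<dots> \<le> real n" using n y aL by (smt (verit) le_divide_eq_1_pos)
        finally have "y * K s \<le> real n / ln (real n)"
          using n_ge by (simp add: field_simps)
        hence "c * K s powr p * y powr p \<le> c * (real n / ln (real n)) powr p"
          using y aL K p c by (simp add: mult.assoc powr_mult[symmetric] mult.commute[of "K s"] powr_mono2)
        also have "\<dots> \<le> counting_fun A n" using n0 n_ge by simp
        also have "counting_fun A n \<le> card {b \<in> B. real b * s \<le> y}"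
          unfolding counting_fun_def
        proof (intro card_mono)
          show "A \<inter> {0..<n} \<subseteq> {b \<in> B. real b * s \<le> y}"
          proof
            fix b assume b: "b \<in> A \<inter> {0..<n}"
            hence "real b \<le> y / s" using n by auto
            moreover from this have "real b \<le> \<tau>" using ys \<tau> by linarith
            ultimately show "b \<in> {b \<in> B. real b * s \<le> y}"
              using b s by (auto simp: B_def field_simps)
          qed
        qed (use fin in auto)
        finally show "c * K s powr p * y powr p \<le> card {b \<in> B. real b * s \<le> y}" by simp
      qed (use aL p s in auto)
      finally show "g * (1 / (s * ln (1 / s))) powr p
        \<le> (\<Sum>b | b \<in> A \<and> real b \<le> \<tau>. exp (- (real b * s)))" by (simp add: B_def)
    qed
  qed
  show ?thesis by (rule that[OF _ ev]) (use aL in auto)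
qed

section \<open>Lower bound for the energy\<close>

lemma sum_tuples_Suc:
  assumes B: "finite B"
  shows "(\<Sum>x\<in>tuples B (Suc m). F x) = (\<Sum>a\<in>B. \<Sum>x\<in>tuples B m. F (a # x))"
proof -
  have "tuples B (Suc m) = (\<lambda>(a, x). a # x) ` (B \<times> tuples B m)"
    by (auto simp: tuples_def length_Suc_conv image_def)
  moreover have "inj_on (\<lambda>(a, x). a # x) (B \<times> tuples B m)"
    by (auto simp: inj_on_def)
  ultimately show ?thesis
    by (simp add: sum.reindex sum.cartesian_product case_prod_unfold)
qed

lemma sum_exp_tuples:
  fixes s :: real
  assumes B: "finite B"
  shows "(\<Sum>x\<in>tuples B m. exp (- (real (sum_list x) * s))) = (\<Sum>b\<in>B. exp (- (real b * s))) ^ m"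
proof (induction m)
  case 0
  have "tuples B 0 = {[]}" by (auto simp: tuples_def)
  thus ?case by simp
next
  case (Suc m)
  have "(\<Sum>x\<in>tuples B (Suc m). exp (- (real (sum_list x) * s)))
      = (\<Sum>a\<in>B. \<Sum>x\<in>tuples B m. exp (- (real a * s)) * exp (- (real (sum_list x) * s)))"
    by (subst sum_tuples_Suc[OF B]) (simp add: algebra_simps flip: exp_add)
  thus ?case by (simp add: Suc sum_product[symmetric] flip: sum_distrib_left sum_distrib_right)
qed

lemma sum_exp_points:
  fixes s :: real
  assumes B: "finite B"
  shows "(\<Sum>q\<in>points B N m. exp (- (real (val q) * s)))
    = (\<Sum>b\<in>B. exp (- (real b * s))) ^ m * (\<Sum>i=1..N. exp (- (real i * s)))"
proof -
  have "(\<Sum>q\<in>points B N m. exp (- (real (val q) * s)))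
      = (\<Sum>x\<in>tuples B m. \<Sum>i=1..N. exp (- (real (sum_list x) * s)) * exp (- (real i * s)))"
    by (simp add: points_def val_def sum.cartesian_product case_prod_unfold algebra_simps flip: exp_add)
  thus ?thesis by (simp add: sum_exp_tuples[OF B] flip: sum_product)
qed

lemma integral_inverse_log:
  assumes "0 < a" "a \<le> b" "b < (1::real)"
  shows "integral {a..b} (\<lambda>s. 1 / (s * ln (1 / s))) = ln (ln (1 / a) / ln (1 / b))"
proof -
  have "((\<lambda>s. 1 / (s * ln (1 / s))) has_integral (- ln (ln (1 / b)) - - ln (ln (1 / a)))) {a..b}"
  proof (rule fundamental_theorem_of_calculus)
    fix x assume x: "x \<in> {a..b}"
    hence "0 < x" "x < 1" using assms by auto
    hence "ln (1 / x) > 0" by simp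
    thus "((\<lambda>s. - ln (ln (1 / s))) has_vector_derivative 1 / (x * ln (1 / x))) (at x within {a..b})"
      unfolding has_real_derivative_iff_has_vector_derivative[symmetric] using \<open>0 < x\<close>
      by (auto intro!: derivative_eq_intros simp: field_simps power2_eq_square)
  qed fact
  moreover have "ln (1 / a) > 0" "ln (1 / b) > 0" using assms by auto
  ultimately show ?thesis by (simp add: integral_unique ln_div)
qed

text \<open>The sum of \<open>exp (- b * s)\<close> over \<open>B\<close>, raised to the power \<open>k\<close>, dominates \<open>g ^ k * w s\<close> with
  \<open>w s = 1 / sqrt (s * ln (1 / s))\<close>. Integrating against \<open>w\<close> produces its Laplace transform \<open>W\<close> at the values
  of the points; this weight makes both sides proportional to the integral of \<open>w\<^sup>2\<close>.\<close>
lemma energy_lower_bound: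
  fixes g s1 s2 :: real
  assumes k: "k > 0" and B: "finite B" and s: "0 < s1" "s1 < s2" "s2 < 1" and g: "g > 0"
    and lower: "\<And>s. s1 \<le> s \<Longrightarrow> s \<le> s2 \<Longrightarrow>
      g * (1 / (s * ln (1 / s))) powr (1 / real (2 * k)) \<le> (\<Sum>b\<in>B. exp (- (real b * s)))"
  shows "g ^ (2 * k) * (real N * exp (- (real N * s2)))\<^sup>2 * ln (ln (1 / s1) / ln (1 / s2))
    \<le> pi * energy B N k"
proof -
  define w where "w s = sqrt (1 / (s * ln (1 / s)))" for s :: real
  define W where "W t = integral {s1..s2} (\<lambda>s. w s * exp (- (real t * s)))" for t :: nat
  define Lam where "Lam = ln (ln (1 / s1) / ln (1 / s2))"
  have pos: "s > 0" "ln (1 / s) > 0" if "s \<in> {s1..s2}" for s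
    using that s by auto
  have w: "continuous_on {s1..s2} w"
    unfolding w_def using pos by (intro continuous_intros) force+
  have w2: "(w s)\<^sup>2 = 1 / (s * ln (1 / s))" if "s \<in> {s1..s2}" for s
    using pos[OF that] by (simp add: w_def)
  have int_w2: "integral {s1..s2} (\<lambda>s. (w s)\<^sup>2) = Lam"
  proof -
    have "integral {s1..s2} (\<lambda>s. (w s)\<^sup>2) = integral {s1..s2} (\<lambda>s. 1 / (s * ln (1 / s)))"
      by (rule integral_cong) (rule w2)
    thus ?thesis using s integral_inverse_log[of s1 s2] by (simp add: Lam_def)
  qed
  have "ln (1 / s1) > ln (1 / s2)" using s by (simp add: ln_div)
  moreover have "ln (1 / s2) > 0" using s by simp
  ultimately have Lam: "Lam > 0" by (simp add: Lam_def)
  have fk: "g ^ k * w s \<le> (\<Sum>b\<in>B. exp (- (real b * s))) ^ k" if "s \<in> {s1..s2}" for s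
  proof -
    define u where "u = 1 / (s * ln (1 / s))"
    have u: "u > 0" using pos[OF that] by (simp add: u_def)
    have "(u powr (1 / real (2 * k))) ^ k = u powr (1 / 2)"
      using u k by (simp add: powr_powr flip: powr_realpow)
    hence "(g * u powr (1 / real (2 * k))) ^ k = g ^ k * w s"
      using u by (simp add: power_mult_distrib w_def u_def powr_half_sqrt)
    moreover have "(g * u powr (1 / real (2 * k))) ^ k \<le> (\<Sum>b\<in>B. exp (- (real b * s))) ^ k"
      using lower[of s] that g by (intro power_mono) (auto simp: u_def)
    ultimately show ?thesis by simp
  qed
  have window: "real N * exp (- (real N * s2)) \<le> (\<Sum>i=1..N. exp (- (real i * s)))"
    if "s \<in> {s1..s2}" for s
  proof -
    have "(\<Sum>i=1..N. exp (- (real N * s2))) \<le> (\<Sum>i=1..N. exp (- (real i * s)))"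
      using that s by (intro sum_mono) (auto intro!: mult_mono)
    thus ?thesis by simp
  qed
  have "g ^ k * (real N * exp (- (real N * s2))) * Lam
      = integral {s1..s2} (\<lambda>s. g ^ k * (real N * exp (- (real N * s2))) * (w s)\<^sup>2)"
    by (simp add: int_w2)
  also have "\<dots> \<le> integral {s1..s2} (\<lambda>s. \<Sum>q\<in>points B N k. w s * exp (- (real (val q) * s)))"
  proof (rule integral_le)
    show "(\<lambda>s. g ^ k * (real N * exp (- (real N * s2))) * (w s)\<^sup>2) integrable_on {s1..s2}"
      by (intro integrable_continuous_real continuous_intros w)
    show "(\<lambda>s. \<Sum>q\<in>points B N k. w s * exp (- (real (val q) * s))) integrable_on {s1..s2}"
      by (intro integrable_continuous_real continuous_intros w)
    fix x assume x: "x \<in> {s1..s2}"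
    have w0: "w x \<ge> 0" using pos[OF x] by (simp add: w_def)
    have "g ^ k * (real N * exp (- (real N * s2))) * (w x)\<^sup>2
        = w x * ((g ^ k * w x) * (real N * exp (- (real N * s2))))"
      by (simp add: power2_eq_square)
    also have "\<dots> \<le> w x * ((\<Sum>b\<in>B. exp (- (real b * x))) ^ k * (\<Sum>i=1..N. exp (- (real i * x))))"
      using w0 fk[OF x] window[OF x] by (intro mult_left_mono mult_mono zero_le_power sum_nonneg) auto
    also have "\<dots> = (\<Sum>q\<in>points B N k. w x * exp (- (real (val q) * x)))"
      by (simp only: sum_exp_points[OF B] flip: sum_distrib_left)
    finally show "g ^ k * (real N * exp (- (real N * s2))) * (w x)\<^sup>2
        \<le> (\<Sum>q\<in>points B N k. w x * exp (- (real (val q) * x)))" .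
  qed
  also have "\<dots> = (\<Sum>q\<in>points B N k. W (val q))"
    unfolding W_def using B
    by (intro integral_sum finite_points integrable_continuous_real continuous_intros w)
  finally have "(g ^ k * (real N * exp (- (real N * s2))) * Lam)\<^sup>2 \<le> (\<Sum>q\<in>points B N k. W (val q))\<^sup>2"
    using g Lam by (intro power_mono) auto
  also have "\<dots> \<le> energy B N k * (\<Sum>t\<in>val ` points B N k. (W t)\<^sup>2)"
    unfolding energy_def by (intro sum_square_le_card_matches finite_points B)
  also have "\<dots> \<le> energy B N k * (pi * integral {s1..s2} (\<lambda>s. (w s)\<^sup>2))"
    unfolding W_def
  proof (intro mult_left_mono sum_Laplace_square_le w)
    show "0 \<notin> val ` points B N k" by (auto simp: points_def val_def)
  qed (use s B finite_points in auto)
  finally have "(g ^ (2 * k) * (real N * exp (- (real N * s2)))\<^sup>2 * Lam) * Lam \<le> (pi * energy B N k) * Lam"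
    unfolding int_w2 by (simp add: power_mult_distrib power_mult power2_eq_square mult_ac)
  thus ?thesis using Lam by (simp add: Lam_def)
qed

section \<open>The extremal constant\<close>

text \<open>The choice \<open>\<tau> = N\<^sup>2 / ln N\<close> makes \<open>(card B) ^ k\<close>, which is \<open>O(sqrt \<tau>)\<close>, of smaller order than
  \<open>N\<close>. With \<open>s1 = L / \<tau>\<close> and \<open>s2 = 1 / (N * ln N)\<close> the window factor \<open>exp (- N * s2)\<close> tends to \<open>1\<close>, while
  \<open>ln (1 / s1) / ln (1 / s2)\<close> tends to \<open>2\<close>; this is the source of \<open>ln 2\<close>.\<close>
lemma Bh_set_constant_bound:
  fixes A :: "nat set" and c g :: real
  assumes Bh: "is_Bh_set (2 * k) A" and k: "k > 0" and c: "c > 0"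
    and g: "0 < g" "g < c * Gamma (1 + 1 / real (2 * k))"
    and count: "eventually (\<lambda>n. c * (real n / ln (real n)) powr (1 / real (2 * k)) \<le> counting_fun A n) sequentially"
  shows "g ^ (2 * k) * ln 2 \<le> pi * (fact k)\<^sup>2"
proof -
  obtain L where L: "L > 0" and ev: "eventually (\<lambda>s. \<forall>\<tau>\<ge>L / s.
      g * (1 / (s * ln (1 / s))) powr (1 / real (2 * k)) \<le> (\<Sum>b | b \<in> A \<and> real b \<le> \<tau>. exp (- (real b * s))))
      (at_right 0)"
    using exp_sum_lower_bound[OF _ c g count] k by auto
  then obtain s0 where s0: "s0 > 0" "\<And>s \<tau>. 0 < s \<Longrightarrow> s < s0 \<Longrightarrow> L / s \<le> \<tau> \<Longrightarrow>
      g * (1 / (s * ln (1 / s))) powr (1 / real (2 * k)) \<le> (\<Sum>b | b \<in> A \<and> real b \<le> \<tau>. exp (- (real b * s)))"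
    by (auto simp: eventually_at_right_field)
  define tau where "tau N = (real N)\<^sup>2 / ln (real N)" for N :: nat
  define s1 where "s1 N = L / tau N" for N
  define s2 where "s2 N = 1 / (real N * ln (real N))" for N :: nat
  define B where "B N = {b. b \<in> A \<and> real b \<le> tau N}" for N
  define Lam where "Lam N = ln (ln (1 / s1 N) / ln (1 / s2 N))" for N
  define C where "C = real (fact (2 * k))"
  have ev_s: "eventually (\<lambda>N. s1 N < s2 N) sequentially"
    unfolding s1_def s2_def tau_def using L by real_asymp
  have ev_s0: "eventually (\<lambda>N. s2 N < s0) sequentially"
    unfolding s2_def using s0(1) by real_asymp
  have ev_1: "eventually (\<lambda>N. s2 N < 1) sequentially"
    unfolding s2_def by real_asymp
  have ev_3: "eventually (\<lambda>N::nat. N \<ge> 3) sequentially"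
    by (rule eventually_ge_at_top)
  have Lam_lim: "Lam \<longlonglongrightarrow> ln 2"
    unfolding Lam_def s1_def s2_def tau_def using L by real_asymp
  have exp_lim: "(\<lambda>N. exp (- (real N * s2 N))) \<longlonglongrightarrow> 1"
    unfolding s2_def by real_asymp
  have root_lim: "(\<lambda>N. sqrt ((real (2 * k) * tau N + 1) * C) / real N) \<longlonglongrightarrow> 0"
  proof -
    have "(\<lambda>N. (real (2 * k) * tau N + 1) * C / (real N)\<^sup>2) \<longlonglongrightarrow> 0"
      unfolding tau_def by real_asymp
    hence "(\<lambda>N. sqrt ((real (2 * k) * tau N + 1) * C / (real N)\<^sup>2)) \<longlonglongrightarrow> sqrt 0"
      by (rule tendsto_real_sqrt)
    thus ?thesis by (simp add: real_sqrt_divide)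
  qed
  have main: "(1 - d) * (g ^ (2 * k) * ln 2) \<le> pi * (fact k)\<^sup>2" if d: "0 < d" "d < 1" for d :: real
  proof -
    define D where "D = d * (real (k\<^sup>2) / d) ^ k"
    have D: "D \<ge> 0" using d by (simp add: D_def)
    let ?lhs = "\<lambda>N. (1 - d) * (g ^ (2 * k) * (exp (- (real N * s2 N)))\<^sup>2 * Lam N)"
    let ?rhs = "\<lambda>N. pi * ((fact k)\<^sup>2 + D * (sqrt ((real (2 * k) * tau N + 1) * C) / real N))"
    have "?lhs \<longlonglongrightarrow> (1 - d) * (g ^ (2 * k) * 1\<^sup>2 * ln 2)"
      by (intro tendsto_intros exp_lim Lam_lim)
    moreover have "?rhs \<longlonglongrightarrow> pi * ((fact k)\<^sup>2 + D * 0)"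
      by (intro tendsto_intros root_lim)
    moreover have "eventually (\<lambda>N. ?lhs N \<le> ?rhs N) sequentially"
      using ev_s ev_s0 ev_1 ev_3
    proof eventually_elim
      case (elim N)
      have N: "real N > 0" "ln (real N) > 0" using elim by auto
      have tau: "tau N > 0" using N by (simp add: tau_def)
      have s1: "s1 N > 0" using L tau by (simp add: s1_def)
      have B_sub: "B N \<subseteq> {..nat \<lfloor>tau N\<rfloor>}" by (auto simp: B_def le_nat_floor)
      hence fin: "finite (B N)" by (rule finite_subset) simp
      have BA: "B N \<subseteq> A" by (auto simp: B_def)
      have lower: "g ^ (2 * k) * (real N * exp (- (real N * s2 N)))\<^sup>2 * ln (ln (1 / s1 N) / ln (1 / s2 N))
          \<le> pi * energy (B N) N k"
      proof (rule energy_lower_bound[OF k fin s1])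
        fix s assume s: "s1 N \<le> s" "s \<le> s2 N"
        have "L / s \<le> L / s1 N" using s s1 L by (intro divide_left_mono) auto
        also have "\<dots> = tau N" using L tau by (simp add: s1_def)
        finally show "g * (1 / (s * ln (1 / s))) powr (1 / real (2 * k)) \<le> (\<Sum>b\<in>B N. exp (- (real b * s)))"
          using s0(2)[of s "tau N"] s s1 elim by (simp add: B_def)
      qed (use elim g in auto)
      have "real (card (B N)) ^ (2 * k) \<le> (real (2 * k) * tau N + 1) * C"
      proof -
        have "card (B N) ^ (2 * k) \<le> (2 * k * nat \<lfloor>tau N\<rfloor> + 1) * fact (2 * k)"
          by (rule card_Bh_set_power_le[OF Bh BA B_sub])
        hence "real (card (B N)) ^ (2 * k) \<le> (real (2 * k) * real (nat \<lfloor>tau N\<rfloor>) + 1) * C"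
          unfolding C_def
          by (metis (no_types, lifting) of_nat_1 of_nat_add of_nat_fact of_nat_le_iff of_nat_mult of_nat_power)
        also have "\<dots> \<le> (real (2 * k) * tau N + 1) * C"
          using tau by (intro mult_right_mono add_mono mult_left_mono) (auto simp: C_def)
        finally show ?thesis .
      qed
      hence "(real (card (B N)) ^ k)\<^sup>2 \<le> (real (2 * k) * tau N + 1) * C"
        by (simp add: power_mult[symmetric] mult.commute)
      hence card_le: "real (card (B N)) ^ k \<le> sqrt ((real (2 * k) * tau N + 1) * C)"
        by (rule real_le_rsqrt)
      have "?lhs N * (real N)\<^sup>2 = (1 - d) * (g ^ (2 * k) * (real N * exp (- (real N * s2 N)))\<^sup>2 * Lam N)"
        by (simp add: power_mult_distrib)
      also have "\<dots> \<le> (1 - d) * (pi * energy (B N) N k)"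
        using lower d by (intro mult_left_mono) (auto simp: Lam_def)
      also have "\<dots> = pi * ((1 - d) * energy (B N) N k)" by simp
      also have "\<dots> \<le> pi * ((fact k)\<^sup>2 * (real N)\<^sup>2 + D * real (card (B N)) ^ k * real N)"
        using energy_upper_bound[OF Bh k fin BA d(1), of N] by (intro mult_left_mono) (auto simp: D_def)
      also have "\<dots> \<le> pi * ((fact k)\<^sup>2 * (real N)\<^sup>2 + D * sqrt ((real (2 * k) * tau N + 1) * C) * real N)"
        using card_le D by (intro mult_left_mono add_left_mono mult_right_mono) auto
      also have "\<dots> = ?rhs N * (real N)\<^sup>2"
        using N by (simp add: field_simps power2_eq_square)
      finally show "?lhs N \<le> ?rhs N" using N by simp
    qed
    ultimately show ?thesis
      using tendsto_le[of sequentially ?rhs _ ?lhs] by fastforce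
  qed
  have "((\<lambda>d. (1 - d) * (g ^ (2 * k) * ln 2)) \<longlongrightarrow> (1 - 0) * (g ^ (2 * k) * ln 2)) (at_right 0)"
    by (intro tendsto_intros)
  moreover have "eventually (\<lambda>d. (1 - d) * (g ^ (2 * k) * ln 2) \<le> pi * (fact k)\<^sup>2) (at_right (0::real))"
    using main by (auto simp: eventually_at_right_field intro!: exI[of _ 1])
  ultimately show ?thesis
    using tendsto_upperbound[of _ "(1 - 0) * (g ^ (2 * k) * ln 2)" "at_right (0::real)" "pi * (fact k)\<^sup>2"]
    by (simp add: trivial_limit_at_right_real)
qed

theorem theorem1:
  fixes h :: nat and A :: "nat set"
  assumes "h > 0" and "even h" and "is_Bh_set h A"
  shows "liminf (\<lambda>n. ereal (real (counting_fun A n) / root h (real n / ln (real n))))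
    \<le> ereal ((pi / ln 2 * (Gamma (1 + real h / 2) ^ 2 / Gamma (1 + 1 / real h) ^ h)) powr (1 / real h))"
proof (rule ccontr)
  define R where "R = pi / ln 2 * (Gamma (1 + real h / 2) ^ 2 / Gamma (1 + 1 / real h) ^ h)"
  define G where "G = Gamma (1 + 1 / real h)"
  obtain k where hk: "h = 2 * k" using assms(2) by (elim evenE)
  have k: "k > 0" using assms(1) hk by simp
  have G: "G > 0" unfolding G_def by (intro Gamma_real_pos) (simp add: add_pos_nonneg)
  have fact: "Gamma (1 + real h / 2) = fact k" by (simp add: hk Gamma_fact)
  have R: "R > 0" unfolding R_def fact using G by (simp add: G_def)
  assume "\<not> ?thesis"
  hence "ereal (R powr (1 / real h)) < liminf (\<lambda>n. ereal (real (counting_fun A n) / root h (real n / ln (real n))))"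
    by (simp add: R_def)
  then obtain c' where c': "ereal (R powr (1 / real h)) < c'"
    "c' < liminf (\<lambda>n. ereal (real (counting_fun A n) / root h (real n / ln (real n))))"
    using dense by blast
  from c'(1) c'(2) obtain c where c: "c' = ereal c" by (cases c') auto
  have Rc: "R powr (1 / real h) < c" using c'(1) c by simp
  hence c0: "c > 0" by (meson le_less_trans powr_ge_zero)
  have "eventually (\<lambda>n. ereal c < ereal (real (counting_fun A n) / root h (real n / ln (real n)))) sequentially"
    using c'(2) unfolding c by (rule less_LiminfD)
  moreover have "eventually (\<lambda>n::nat. n \<ge> 3) sequentially" by (rule eventually_ge_at_top)
  ultimately have count: "eventually (\<lambda>n. c * (real n / ln (real n)) powr (1 / real (2 * k)) \<le> counting_fun A n) sequentially"
  proof eventually_elim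
    case (elim n)
    hence "real n / ln (real n) > 0" by simp
    moreover from this have "root h (real n / ln (real n)) > 0" using assms(1) by simp
    ultimately show ?case using elim assms(1) by (simp add: field_simps root_powr_inverse hk)
  qed
  have bound: "g ^ h * ln 2 \<le> pi * (fact k)\<^sup>2" if "0 < g" "g < c * G" for g
    using Bh_set_constant_bound[OF _ k c0 that(1) _ count] that(2) assms(3) by (simp add: hk G_def)
  have "(\<lambda>g. g ^ h * ln 2) \<midarrow>c * G\<rightarrow> (c * G) ^ h * ln 2" by (intro tendsto_intros)
  hence "((\<lambda>g. g ^ h * ln 2) \<longlongrightarrow> (c * G) ^ h * ln 2) (at_left (c * G))"
    by (rule filterlim_mono) (auto simp: at_le)
  moreover have "eventually (\<lambda>g. g ^ h * ln 2 \<le> pi * (fact k)\<^sup>2) (at_left (c * G))"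
    using bound c0 G by (auto simp: eventually_at_left_field intro!: exI[of _ 0])
  ultimately have "(c * G) ^ h * ln 2 \<le> pi * (fact k)\<^sup>2"
    by (rule tendsto_upperbound) (simp add: trivial_limit_at_left_real)
  moreover have "R = pi / ln 2 * ((fact k)\<^sup>2 / G ^ h)" by (simp only: R_def fact G_def)
  ultimately have "c ^ h * (G ^ h * ln 2) \<le> R * (G ^ h * ln 2)"
    using G by (simp add: power_mult_distrib)
  hence "c ^ h \<le> R" by (rule mult_right_le_imp_le) (use G in simp)
  moreover have "R < c ^ h"
  proof -
    have "R = (R powr (1 / real h)) ^ h" using R assms(1) by (simp add: powr_powr flip: powr_realpow)
    also have "\<dots> < c ^ h" using Rc assms(1) by (intro power_strict_mono) auto
    finally show ?thesis .
  qed
  ultimately show False by simp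
qed

end
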